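(* Let $t$ be an even positive integer and let $G$ be a finite graph with $\mathrm{coind}(B_0(G))\ge t-1$ (i.e. $G$ is topologically $t$-chromatic). Then $\chi_c(G)\ge t$.
   Context: Circular chromatic number: for positive integers $p,q$, a map $c:V(G)\to\{1,\dots,p\}$ is a $(p,q)$-coloring if $q\le|c(u)-c(v)|\le p-q$ for all adjacent $u,v$; $\chi_c(G)=\inf\{p/q:$ $G$ has a $(p,q)$-coloring$\}$. Box complex: $B_0(G)$ is the simplicial complex on $V(G)\times\{1,2\}$ whose simplices are the sets $S\times\{1\}\cup T\times\{2\}$ with $S,T\subseteq V(G)$, $S\cap T=\emptyset$, and every vertex of $S$ adjacent to every vertex of $T$. Swapping the two parts induces a free continuous involution $\nu$ on the geometric realization $\|B_0(G)\|$. $\mathrm{coind}(B_0(G))$ is the largest $d\ge0$ such that there is a continuous $f:S^d\to\|B_0(G)\|$ with $f(-x)=\nu(f(x))$ for all $x$ ($\infty$ if such maps exist for all $d$). *)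

theory Defs
  imports "HOL-Analysis.Analysis" "Graph_Theory.Pair_Digraph"
begin

text \<open>
  A finite simple graph is a \<open>pair_graph\<close>: finite vertex set, and a symmetric irreflexive
  relation \<open>parcs\<close> (each edge is stored as its two arcs), so \<open>u\<close> and \<open>v\<close> are adjacent iff
  \<open>(u, v) \<in> parcs G\<close>.
\<close>

definition pq_coloring :: "'a pair_pre_digraph \<Rightarrow> nat \<Rightarrow> nat \<Rightarrow> ('a \<Rightarrow> int) \<Rightarrow> bool" where
  "pq_coloring G p q c \<longleftrightarrow>
     c ` pverts G \<subseteq> {1..int p} \<and>
     (\<forall>(u, v) \<in> parcs G. int q \<le> \<bar>c u - c v\<bar> \<and> \<bar>c u - c v\<bar> \<le> int p - int q)"

text \<open>
  For a finite simple graph the infimum below is over a nonempty set of positive reals (an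
  injective coloring is a \<open>(p, 1)\<close>-coloring), so the real-valued \<^const>\<open>Inf\<close> is meaningful.
\<close>

definition circular_chromatic_number :: "'a pair_pre_digraph \<Rightarrow> real" where
  "circular_chromatic_number G =
     Inf {real p / real q | p q. 0 < p \<and> 0 < q \<and> (\<exists>c. pq_coloring G p q c)}"

text \<open>\<open>V \<times> {1, 2}\<close> is encoded as \<open>V \<times> bool\<close>, with \<open>False\<close> for 1 and \<open>True\<close> for 2.\<close>

definition box_complex :: "'a pair_pre_digraph \<Rightarrow> ('a \<times> bool) set set" where
  "box_complex G =
     {S \<times> {False} \<union> T \<times> {True} | S T.
        S \<subseteq> pverts G \<and> T \<subseteq> pverts G \<and> S \<inter> T = {} \<and> S \<times> T \<subseteq> parcs G}"

text \<open>
  Geometric realization by barycentric coordinates, as a subspace of the product \<open>\<real>\<^sup>V\<close>. For finite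
  complexes \<open>K\<close>, the only ones needed here, this is the usual topology.
\<close>

definition geometric_realization :: "'v set set \<Rightarrow> ('v \<Rightarrow> real) topology" where
  "geometric_realization K =
     subtopology (powertop_real UNIV)
       {x. (\<forall>v. 0 \<le> x v) \<and> {v. x v \<noteq> 0} \<in> K \<and> (\<Sum>v | x v \<noteq> 0. x v) = 1}"

definition box_involution :: "('a \<times> bool \<Rightarrow> real) \<Rightarrow> ('a \<times> bool \<Rightarrow> real)" where
  "box_involution x = (\<lambda>(v, b). x (v, \<not> b))"

text \<open>
  \<^term>\<open>nsphere d\<close> is the unit sphere of dimension \<open>d\<close>, realized inside \<open>\<real>\<^sup>\<nat>\<close>; its antipodal map
  is coordinatewise negation. The supremum in \<^typ>\<open>enat\<close> is the maximum if such \<open>d\<close> are bounded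
  and \<open>\<infinity>\<close> otherwise. If there is no such \<open>d\<close> at all (for an involution \<open>\<nu>\<close> of \<open>X\<close>, only if \<open>X\<close> is empty) it is 0.
\<close>

definition coind :: "'b topology \<Rightarrow> ('b \<Rightarrow> 'b) \<Rightarrow> enat" where
  "coind X \<nu> =
     Sup {enat d | d. \<exists>f. continuous_map (nsphere d) X f \<and>
                          (\<forall>x \<in> topspace (nsphere d). f (\<lambda>i. - x i) = \<nu> (f x))}"

end

theory Submission
  imports Defs "HOL-Homology.Homology"
begin

text \<open>
  Label a point \<open>x\<close> of the sphere by a vertex \<open>(v, b)\<close> of the box complex that carries much of the
  weight of \<open>f x\<close>, encoded as the integer \<open>2 * c v + of_bool b\<close>; this can be done so that antipodal
  points get labels that differ in the parity only. The labels of sufficiently close points span a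
  simplex of the box complex. A version of Ky Fan's theorem then yields \<open>t\<close> labels within one simplex
  that alternate in parity when sorted. Vertices on opposite sides of a simplex are adjacent, so
  consecutive colors differ by at least \<open>q\<close>, and since \<open>t\<close> is even, so do the first and the last one
  cyclically: \<open>(t - 1) * q \<le> p - q\<close>.

  Ky Fan's theorem itself is a parity count on singular chains \<open>c k\<close> with
  \<open>\<partial> (c (k + 1)) = c k \<plusminus> \<nu> (c k)\<close>, which exist since spheres have no homology in low degrees, and which
  are subdivided until all simplices are small.
\<close>

subsection \<open>Alternating sequences\<close>

primrec alternating :: "bool \<Rightarrow> bool list \<Rightarrow> bool" where
  "alternating b [] = True"
| "alternating b (x # xs) = (x = b \<and> alternating (\<not> b) xs)"

lemma alternating_map_Not: "alternating b (map Not xs) = alternating (\<not> b) xs"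
  by (induction xs arbitrary: b) auto

lemma alternating_nth: "alternating b xs \<Longrightarrow> i < length xs \<Longrightarrow> xs ! i = (if even i then b else \<not> b)"
proof (induction xs arbitrary: b i)
  case (Cons x xs)
  then show ?case
    by (cases i) auto
qed simp

section \<open>Deleting an entry from a list of signs or labels\<close>

definition delete_nth :: "nat \<Rightarrow> 'a list \<Rightarrow> 'a list" where
  "delete_nth i xs = take i xs @ drop (Suc i) xs"

lemma delete_nth_0 [simp]: "delete_nth 0 (x # xs) = xs"
  and delete_nth_Suc [simp]: "delete_nth (Suc i) (x # xs) = x # delete_nth i xs"
  by (simp_all add: delete_nth_def)

lemma map_delete_nth: "map f (delete_nth i xs) = delete_nth i (map f xs)"
  by (simp add: delete_nth_def take_map drop_map)

lemma mset_delete_nth: "i < length xs \<Longrightarrow> mset (delete_nth i xs) = mset xs - {#xs ! i#}"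
  by (subst (2) id_take_nth_drop[of i xs]) (auto simp: delete_nth_def)

lemma sorted_delete_nth:
  assumes "sorted xs"
  shows "sorted (delete_nth i xs)"
proof (cases "i < length xs")
  case True
  then have "sorted (take i xs @ xs ! i # drop (Suc i) xs)"
    using assms id_take_nth_drop by metis
  then show ?thesis
    unfolding delete_nth_def by (auto simp: sorted_append)
qed (use assms in \<open>simp add: delete_nth_def\<close>)

text \<open>The local step of Fan's count: modulo two, the facets of a simplex that alternate
  starting with \<open>b\<close> detect whether the simplex itself alternates with either start.
  Induction on the head: deleting it leaves \<open>xs\<close>, while any other deletion keeps it and
  so contributes only if \<open>x = b\<close> and the rest alternates from \<open>\<not> b\<close>.
  The empty list alternates with both starts, so the base case subtracts two.\<close>

lemma sum_alternating_delete_nth: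
  "even ((\<Sum>i<length xs. of_bool (alternating b (delete_nth i xs)))
     - of_bool (alternating b xs) - of_bool (alternating (\<not> b) xs) :: int)"
proof (induction xs arbitrary: b)
  case (Cons x xs)
  define S :: "bool \<Rightarrow> int" where
    "S b = (\<Sum>i<length xs. of_bool (alternating b (delete_nth i xs)))" for b
  define D :: int where "D = (\<Sum>i<length (x # xs). of_bool (alternating b (delete_nth i (x # xs))))"
  have "D =
     of_bool (alternating b xs) + of_bool (x = b) * S (\<not> b)"
    by (simp add: sum.lessThan_Suc_shift S_def D_def del: sum.lessThan_Suc)
  moreover have "even (S (\<not> b) - of_bool (alternating (\<not> b) xs) - of_bool (alternating b xs))"
    using Cons.IH[of "\<not> b"] by (simp add: S_def)
  ultimately have "even (D - of_bool (alternating b (x # xs)) - of_bool (alternating (\<not> b) (x # xs)))"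
    by (cases "x = b"; cases "alternating b xs"; cases "alternating (\<not> b) xs") simp_all
  then show ?case
    unfolding D_def .
qed simp

text \<open>Removing an entry and then sorting depends only on the value removed, and
  \<open>xs\<close> and \<open>sort xs\<close> run through the same values with the same
  multiplicities. This carries the count for sorted lists over to simplices whose vertices come in
  any order.\<close>

lemma sum_delete_nth_sort:
  fixes g :: "'a::linorder list \<Rightarrow> int"
  shows "(\<Sum>i<length xs. g (sort (delete_nth i xs))) = (\<Sum>i<length xs. g (delete_nth i (sort xs)))"
proof -
  define h where "h x = g (sorted_list_of_multiset (mset xs - {#x#}))" for x
  have h: "(\<Sum>i<length ys. h (ys ! i)) = sum_mset (image_mset h (mset ys))" for ys
  proof -
    have "sum_mset (image_mset h (mset ys)) = sum_list (map h ys)"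
      by (metis mset_map sum_mset_sum_list)
    then show ?thesis
      by (simp add: sum_list_sum_nth atLeast0LessThan)
  qed
  have "g (sort (delete_nth i xs)) = h (xs ! i)" if "i < length xs" for i
    using that by (simp add: h_def flip: mset_delete_nth)
  moreover have "g (delete_nth i (sort xs)) = h (sort xs ! i)" if "i < length xs" for i
  proof -
    have "mset xs - {#sort xs ! i#} = mset (delete_nth i (sort xs))"
      using that by (simp add: mset_delete_nth)
    then show ?thesis
      by (simp add: h_def sorted_sort_id[OF sorted_delete_nth[OF sorted_sort]])
  qed
  ultimately show ?thesis
    using h[of xs] h[of "sort xs"] by simp
qed

text \<open>The involution exchanging \<open>2 * m\<close> and \<open>2 * m + 1\<close>. On labels
  \<open>2 * c v + of_bool b\<close> it swaps the two copies of \<open>v\<close> in the box complex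
  and plays the role of negation in the usual form of Fan's theorem.\<close>

definition flip :: "int \<Rightarrow> int" where
  "flip l = (if even l then l + 1 else l - 1)"

lemma odd_flip [simp]: "odd (flip l) \<longleftrightarrow> even l"
  by (simp add: flip_def)

text \<open>\<open>flip\<close> reverses the order only inside a pair \<open>2 * m\<close>,
  \<open>2 * m + 1\<close>. The assumption says that no such pair occurs in the list, so
  \<open>flip\<close> is monotone there.\<close>

lemma sort_map_flip:
  assumes "\<And>x y. x \<in> set ls \<Longrightarrow> y \<in> set ls \<Longrightarrow> y \<noteq> flip x"
  shows "sort (map flip ls) = map flip (sort ls)"
proof -
  have "flip x \<le> flip y" if "x \<in> set ls" "y \<in> set ls" "x \<le> y" for x y
  proof -
    have "x = y \<or> even x \<and> x + 2 \<le> y \<or> odd x \<and> x + 1 \<le> y"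
      using assms[OF that(1,2)] that(3) by (auto simp: flip_def split: if_splits)
    then show ?thesis
      by (auto simp: flip_def)
  qed
  then have "sorted (map flip (sort ls))"
    unfolding sorted_map by (intro sorted_wrt_mono_rel[OF _ sorted_sort]) auto
  then show ?thesis
    by (metis mset_map mset_sort properties_for_sort)
qed

text \<open>Sorting makes the property independent of the vertex order of a simplex. Equal labels
  become neighbours of equal parity, so alternation forces the labels to be distinct.\<close>

definition alternating_labels :: "bool \<Rightarrow> int list \<Rightarrow> bool" where
  "alternating_labels b ls \<longleftrightarrow> alternating b (map odd (sort ls))"

lemma sum_alternating_labels_delete_nth:
  "even ((\<Sum>i<length ls. of_bool (alternating_labels b (delete_nth i ls)))
     - of_bool (alternating_labels b ls) - of_bool (alternating_labels (\<not> b) ls) :: int)"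
  using sum_alternating_delete_nth[of b "map odd (sort ls)"]
    sum_delete_nth_sort[of "\<lambda>xs. of_bool (alternating b (map odd xs))" ls]
  by (simp add: alternating_labels_def map_delete_nth)

lemma alternating_labels_map_flip:
  assumes "\<And>x y. x \<in> set ls \<Longrightarrow> y \<in> set ls \<Longrightarrow> y \<noteq> flip x"
  shows "alternating_labels b (map flip ls) = alternating_labels (\<not> b) ls"
proof -
  have "sort (map flip ls) = map flip (sort ls)"
    using assms by (rule sort_map_flip)
  then have "map odd (sort (map flip ls)) = map Not (map odd (sort ls))"
    by simp
  then show ?thesis
    unfolding alternating_labels_def by (simp only: alternating_map_Not)
qed

subsection \<open>Antipodal chains on the sphere\<close>

abbreviation antipode :: "(nat \<Rightarrow> real) \<Rightarrow> nat \<Rightarrow> real" where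
  "antipode x \<equiv> \<lambda>i. - x i"

lemma continuous_map_antipode: "continuous_map (nsphere d) (nsphere d) antipode"
proof -
  have "continuous_map (powertop_real UNIV) euclideanreal (\<lambda>x. - x k)" for k :: nat
    by (metis UNIV_I continuous_map_product_projection continuous_map_minus)
  then show ?thesis
    by (force simp: nsphere continuous_map_in_subtopology continuous_map_componentwise_UNIV
        intro: continuous_map_from_subtopology)
qed

lemma chain_map_antipode_antipode:
  assumes "singular_chain k X c"
  shows "chain_map k antipode (chain_map k antipode c) = c"
proof -
  have "chain_map k antipode (chain_map k antipode c) = chain_map k (antipode \<circ> antipode) c"
    by (simp add: chain_map_compose)
  also have "\<dots> = c"
    using assms by (rule chain_map_id_gen) simp
  finally show ?thesis .
qed

text \<open>The reduced homology of the sphere vanishes below degree \<open>d\<close>. In degree 0 a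
  cycle represents a reduced class only if its image in a one-point space vanishes, which is the
  last assumption.\<close>

lemma singular_relboundary_nsphere:
  assumes "k < d" and z: "singular_relcycle k (nsphere d) {} z"
    and "k = 0 \<Longrightarrow> chain_map 0 (\<lambda>x. ()) z = 0"
  shows "singular_relboundary k (nsphere d) {} z"
proof -
  let ?X = "nsphere d" and ?P = "discrete_topology {()}"
  let ?h = "homologous_rel_set k ?X {} z"
  have h: "?h \<in> carrier (homology_group k ?X)"
    using z by (simp add: carrier_relative_homology_group)
  have "?h \<in> carrier (reduced_homology_group k ?X)"
  proof (cases "k = 0")
    case True
    have "hom_induced (int k) ?X {} ?P {} (\<lambda>x. ()) ?h
        = homologous_rel_set k ?P {} (chain_map k (\<lambda>x. ()) z)"
      using z by (intro hom_induced_chain_map) auto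
    also have "\<dots> = singular_relboundary_set k ?P {}"
      using assms(3) True by (simp add: homologous_rel_set_eq_relboundary)
    finally show ?thesis
      using h True by (simp add: carrier_reduced_homology_group kernel_def
          one_relative_homology_group[of 0, simplified])
  next
    case False
    then show ?thesis
      using h by (simp add: un_reduced_homology_group)
  qed
  moreover have "trivial_group (reduced_homology_group k ?X)"
    using \<open>k < d\<close> by (simp add: trivial_reduced_homology_group_nsphere)
  ultimately have "?h = \<one>\<^bsub>homology_group k ?X\<^esub>"
    by (auto simp: trivial_group_def one_reduced_homology_group)
  then show ?thesis
    by (simp add: homologous_rel_set_eq_relboundary)
qed

text \<open>
  One may think of \<open>c k\<close> as a \<open>k\<close>-dimensional hemisphere, whose boundary consists of two antipodal
  hemispheres one dimension lower. The sign is the one that makes the right-hand side a cycle.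
\<close>

lemma antipodal_chains:
  obtains c :: "nat \<Rightarrow> (nat \<Rightarrow> real) chain" and a
  where "\<And>k. k \<le> d \<Longrightarrow> singular_chain k (nsphere d) (c k)"
    and "singular_simplex 0 (nsphere d) a" and "c 0 = frag_of a"
    and "\<And>k. k < d \<Longrightarrow> chain_boundary (Suc k) (c (Suc k)) =
           c k + frag_cmul ((-1) ^ Suc k) (chain_map k antipode (c k))"
proof -
  let ?X = "nsphere d"
  let ?T = "\<lambda>k. chain_map k antipode"
  define a :: "(nat \<Rightarrow> real) \<Rightarrow> nat \<Rightarrow> real"
    where "a = restrict (\<lambda>y i. if i = 0 then 1 else 0) (standard_simplex 0)"
  have a: "singular_simplex 0 ?X a"
    unfolding singular_simplex_def
  proof
    let ?S = "subtopology (powertop_real UNIV) (standard_simplex 0)"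
    have "continuous_map ?S ?X (\<lambda>y i. if i = 0 then 1 else 0)"
      using in_topspace_nsphere by (simp add: continuous_map_const)
    then show "continuous_map ?S ?X a"
      by (rule continuous_map_eq) (simp add: a_def)
  qed (simp add: a_def)
  define bd where "bd k c = c + frag_cmul ((-1) ^ Suc k) (?T k c)" for k c
  \<comment> \<open>The last conjunct is the invariant of the construction: the antipode acts on the
    boundary of \<open>c\<close> as the sign \<open>(-1) ^ k\<close>. Hence the two terms of the
    boundary of \<open>bd k c\<close> cancel, and \<open>bd k c\<close> is a cycle. Above degree
    \<open>d\<close> the predicate holds vacuously, so that the choice can run over all
    \<open>k\<close>.\<close>
  define P where "P k c \<longleftrightarrow> (k \<le> d \<longrightarrow> singular_chain k ?X c \<and> (k = 0 \<longrightarrow> c = frag_of a) \<and>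
     (\<forall>j. k = Suc j \<longrightarrow>
        ?T j (chain_boundary k c) = frag_cmul ((-1) ^ k) (chain_boundary k c)))" for k c
  have sgn: "(-1 :: int) ^ m * (-1) ^ m = 1" for m
    by (simp flip: power_mult_distrib)
  have T: "singular_chain k ?X (?T k c)" if "singular_chain k ?X c" for k c
    using that continuous_map_antipode by (rule singular_chain_chain_map)
  \<comment> \<open>The antipode is an involution on chains, so it exchanges the two summands of
    \<open>bd k c\<close> up to the sign. This is the invariant for the next degree.\<close>
  have TT: "?T k (bd k c) = frag_cmul ((-1) ^ Suc k) (bd k c)" if "singular_chain k ?X c" for k c
    unfolding bd_def chain_map_add chain_map_cmul chain_map_antipode_antipode[OF that]
      frag_cmul_distrib2 frag_cmul_cmul sgn frag_cmul_one by (rule add.commute)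
  have "\<exists>c. \<forall>k. P k (c k) \<and> (k < d \<longrightarrow> chain_boundary (Suc k) (c (Suc k)) = bd k (c k))"
  proof (rule dependent_nat_choice)
    show "\<exists>c. P 0 c"
      unfolding P_def using a by (auto simp: singular_chain_of)
  next
    fix c k
    assume P: "P k c"
    show "\<exists>c'. P (Suc k) c' \<and> (k < d \<longrightarrow> chain_boundary (Suc k) c' = bd k c)"
    proof (cases "k < d")
      case True
      then have c: "singular_chain k ?X c"
        using P by (simp add: P_def)
      have bdc: "singular_chain k ?X (bd k c)"
        unfolding bd_def by (intro singular_chain_add singular_chain_cmul T c)
      have "chain_boundary k (bd k c) = 0"
      proof (cases k)
        case (Suc j)
        then have "?T j (chain_boundary k c) = frag_cmul ((-1) ^ k) (chain_boundary k c)"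
          using P True Suc by (auto simp: P_def)
        then have "chain_boundary k (?T k c) = frag_cmul ((-1) ^ k) (chain_boundary k c)"
          using Suc chain_boundary_chain_map[OF c, of antipode] by simp
        then show ?thesis
          by (simp add: bd_def chain_boundary_add chain_boundary_cmul sgn)
      qed (simp add: chain_boundary_def)
      then have "singular_relcycle k ?X {} (bd k c)"
        using bdc by (simp add: singular_cycle)
      \<comment> \<open>For \<open>k = 0\<close> the sign is negative: \<open>bd 0 c\<close> is a
        difference of two chains with the same image in a point.\<close>
      moreover have "chain_map 0 (\<lambda>x. ()) (bd k c) = 0" if "k = 0"
      proof -
        have "chain_map 0 (\<lambda>x. ()) (?T 0 c) = chain_map 0 (\<lambda>x. ()) c"
          using chain_map_compose[of 0 "\<lambda>x. ()" antipode] by (simp add: comp_def fun_eq_iff)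
        then show ?thesis
          using that by (simp add: bd_def chain_map_diff)
      qed
      ultimately have "singular_relboundary k ?X {} (bd k c)"
        using True by (intro singular_relboundary_nsphere)
      then obtain c' where c': "singular_chain (Suc k) ?X c'" "chain_boundary (Suc k) c' = bd k c"
        by (auto simp: singular_boundary)
      then have "P (Suc k) c'"
        using TT[OF c] by (simp add: P_def)
      then show ?thesis
        using c' by blast
    qed (auto simp: P_def)
  qed
  then obtain c where c: "\<And>k. P k (c k)"
      "\<And>k. k < d \<Longrightarrow> chain_boundary (Suc k) (c (Suc k)) = bd k (c k)"
    by metis
  show thesis
  proof
    show "singular_chain k ?X (c k)" if "k \<le> d" for k
      using c(1)[of k] that unfolding P_def by blast
    show "c 0 = frag_of a"
      using c(1)[of 0] unfolding P_def by blast
    show "chain_boundary (Suc k) (c (Suc k)) = c k + frag_cmul ((-1) ^ Suc k) (?T k (c k))"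
      if "k < d" for k
      using c(2)[OF that] unfolding bd_def .
  qed (rule a)
qed

subsection \<open>Ky Fan's theorem\<close>

definition vertex_labels :: "('a \<Rightarrow> int) \<Rightarrow> nat \<Rightarrow> ((nat \<Rightarrow> real) \<Rightarrow> 'a) \<Rightarrow> int list" where
  "vertex_labels L k \<sigma> = map (\<lambda>i. L (simplicial_vertex i \<sigma>)) [0..<Suc k]"

lemma length_vertex_labels [simp]: "length (vertex_labels L k \<sigma>) = Suc k"
  by (simp add: vertex_labels_def)

lemma vertex_labels_singular_face:
  assumes "j \<le> Suc k"
  shows "vertex_labels L k (singular_face (Suc k) j \<sigma>) = delete_nth j (vertex_labels L (Suc k) \<sigma>)"
proof (rule nth_equalityI)
  fix i
  assume "i < length (vertex_labels L k (singular_face (Suc k) j \<sigma>))"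
  then have i: "i \<le> k"
    by simp
  have "simplical_face j (\<lambda>m. if m = i then 1 else 0 :: real) =
      (\<lambda>m. if m = (if i < j then i else Suc i) then 1 else 0)"
    by (auto simp: simplical_face_def fun_eq_iff)
  then have "simplicial_vertex i (singular_face (Suc k) j \<sigma>) =
      simplicial_vertex (if i < j then i else Suc i) \<sigma>"
    using i by (simp add: simplicial_vertex_def singular_face_def)
  then show "vertex_labels L k (singular_face (Suc k) j \<sigma>) ! i =
      delete_nth j (vertex_labels L (Suc k) \<sigma>) ! i"
    using i assms unfolding vertex_labels_def delete_nth_def
    by (simp add: nth_append min_def del: upt_Suc)
qed (use assms in \<open>auto simp: delete_nth_def min_def\<close>)

lemma vertex_labels_simplex_map:
  "vertex_labels L k (simplex_map k g \<sigma>) = vertex_labels (L \<circ> g) k \<sigma>"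
  by (auto simp: vertex_labels_def simplex_map_def simplicial_vertex_def)

text \<open>The number of alternating simplices in a chain, counted with their coefficients. Chains
  over the unit type are a copy of the integers, so the count inherits its linearity from
  \<open>frag_extend\<close>. Only its parity matters later.\<close>

definition alternating_count :: "bool \<Rightarrow> ('a \<Rightarrow> int) \<Rightarrow> nat \<Rightarrow> 'a chain \<Rightarrow> int" where
  "alternating_count b L k c = poly_mapping.lookup
     (frag_extend (\<lambda>\<sigma>. frag_cmul (of_bool (alternating_labels b (vertex_labels L k \<sigma>))) (frag_of ())) c) ()"

lemma alternating_count_0 [simp]: "alternating_count b L k 0 = 0"
  and alternating_count_frag_of [simp]:
    "alternating_count b L k (frag_of \<sigma>) = of_bool (alternating_labels b (vertex_labels L k \<sigma>))"
  and alternating_count_add: "alternating_count b L k (x + y) = alternating_count b L k x + alternating_count b L k y"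
  and alternating_count_diff: "alternating_count b L k (x - y) = alternating_count b L k x - alternating_count b L k y"
  and alternating_count_cmul: "alternating_count b L k (frag_cmul m x) = m * alternating_count b L k x"
  by (simp_all add: alternating_count_def frag_extend_add frag_extend_diff frag_extend_cmul
      lookup_add lookup_minus)

lemma alternating_count_sum:
  "alternating_count b L k (sum f I) = (\<Sum>i\<in>I. alternating_count b L k (f i))"
  by (induction I rule: infinite_finite_induct) (simp_all add: alternating_count_add)

lemma alternating_count_eq_0:
  assumes "\<And>\<sigma>. \<sigma> \<in> Poly_Mapping.keys c \<Longrightarrow> \<not> alternating_labels b (vertex_labels L k \<sigma>)"
  shows "alternating_count b L k c = 0"
proof -
  have "frag_extend (\<lambda>\<sigma>. frag_cmul (of_bool (alternating_labels b (vertex_labels L k \<sigma>))) (frag_of ())) c = 0"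
    by (rule frag_extend_eq_0) (simp add: assms)
  then show ?thesis
    by (simp add: alternating_count_def)
qed

text \<open>Modulo two the signs in the boundary disappear, so on a single simplex this is the local
  count over its facets. Both sides are additive in the chain.\<close>

lemma alternating_count_chain_boundary:
  "even (alternating_count b L k (chain_boundary (Suc k) c)
     - alternating_count b L (Suc k) c - alternating_count (\<not> b) L (Suc k) c)"
  using subset_UNIV
proof (induction c rule: frag_induction)
  case (one \<sigma>)
  let ?ls = "vertex_labels L (Suc k) \<sigma>"
  define N :: "nat \<Rightarrow> int" where "N j = of_bool (alternating_labels b (delete_nth j ?ls))" for j
  have "alternating_count b L k (chain_boundary (Suc k) (frag_of \<sigma>)) = (\<Sum>j\<le>Suc k. (-1) ^ j * N j)"
    by (simp add: chain_boundary_of alternating_count_sum alternating_count_cmul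
        vertex_labels_singular_face N_def del: sum.atMost_Suc)
  moreover have "even ((\<Sum>j\<le>Suc k. (-1) ^ j * N j) - (\<Sum>j\<le>Suc k. N j))"
    unfolding sum_subtractf[symmetric] by (intro dvd_sum) auto
  moreover have "even ((\<Sum>j\<le>Suc k. N j) - of_bool (alternating_labels b ?ls)
      - of_bool (alternating_labels (\<not> b) ?ls))"
    using sum_alternating_labels_delete_nth[of b ?ls]
    by (simp add: N_def lessThan_Suc_atMost del: sum.atMost_Suc sum.lessThan_Suc)
  ultimately show ?case
    by (simp only: alternating_count_frag_of) presburger
next
  case (diff a b')
  then show ?case
    unfolding chain_boundary_diff alternating_count_diff by presburger
qed simp

text \<open>Applying \<open>g\<close> flips every label of a simplex. As its vertices lie in a set
  without complementary labels, flipping commutes with sorting and just exchanges the two possible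
  starting parities.\<close>

lemma alternating_count_chain_map:
  assumes "\<And>\<sigma>. \<sigma> \<in> Poly_Mapping.keys c \<Longrightarrow>
     \<exists>U. (\<forall>i\<le>k. simplicial_vertex i \<sigma> \<in> U) \<and> (\<forall>x\<in>U. L (g x) = flip (L x)) \<and> (\<forall>x\<in>U. \<forall>y\<in>U. L y \<noteq> flip (L x))"
  shows "alternating_count b L k (chain_map k g c) = alternating_count (\<not> b) L k c"
proof -
  let ?S = "{\<sigma>. \<exists>U. (\<forall>i\<le>k. simplicial_vertex i \<sigma> \<in> U) \<and> (\<forall>x\<in>U. L (g x) = flip (L x)) \<and>
      (\<forall>x\<in>U. \<forall>y\<in>U. L y \<noteq> flip (L x))}"
  have "Poly_Mapping.keys c \<subseteq> ?S"
    using assms by blast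
  then show ?thesis
  proof (induction c rule: frag_induction)
    case (one \<sigma>)
    then obtain U where U: "\<And>i. i \<le> k \<Longrightarrow> simplicial_vertex i \<sigma> \<in> U"
        "\<And>x. x \<in> U \<Longrightarrow> L (g x) = flip (L x)" "\<And>x y. x \<in> U \<Longrightarrow> y \<in> U \<Longrightarrow> L y \<noteq> flip (L x)"
      by blast
    have "vertex_labels (L \<circ> g) k \<sigma> = map flip (vertex_labels L k \<sigma>)"
      using U(1,2) by (simp add: vertex_labels_def del: upt_Suc)
    moreover have "alternating_labels b (map flip (vertex_labels L k \<sigma>)) =
        alternating_labels (\<not> b) (vertex_labels L k \<sigma>)"
      by (rule alternating_labels_map_flip) (use U(1,3) in \<open>auto simp: vertex_labels_def simp del: upt_Suc\<close>)
    ultimately show ?case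
      by (simp add: vertex_labels_simplex_map)
  qed (simp_all add: chain_map_diff alternating_count_diff)
qed

section \<open>Iterated barycentric subdivision of chains\<close>

lemma singular_subdivision_power_add:
  "(singular_subdivision p ^^ n) (a + b) = (singular_subdivision p ^^ n) a + (singular_subdivision p ^^ n) b"
  by (induction n) (simp_all add: singular_subdivision_add)

lemma singular_subdivision_power_cmul:
  "(singular_subdivision p ^^ n) (frag_cmul m a) = frag_cmul m ((singular_subdivision p ^^ n) a)"
  by (induction n) (simp_all add: singular_subdivision_def frag_extend_cmul)

lemma singular_chain_singular_subdivision_power:
  "singular_chain p X c \<Longrightarrow> singular_chain p X ((singular_subdivision p ^^ n) c)"
  by (induction n) (simp_all add: singular_chain_singular_subdivision)

lemma singular_subdivision_power_zero:
  "singular_chain 0 X c \<Longrightarrow> (singular_subdivision 0 ^^ n) c = c"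
  by (induction n) (simp_all add: singular_subdivision_zero)

lemma naturality_singular_subdivision_power:
  assumes "singular_chain p X c"
  shows "(singular_subdivision p ^^ n) (chain_map p g c) = chain_map p g ((singular_subdivision p ^^ n) c)"
  by (induction n)
    (simp_all add: naturality_singular_subdivision[OF singular_chain_singular_subdivision_power[OF assms]])

lemma chain_boundary_singular_subdivision_power:
  assumes "singular_chain (Suc p) X c"
  shows "chain_boundary (Suc p) ((singular_subdivision (Suc p) ^^ n) c) =
    (singular_subdivision p ^^ n) (chain_boundary (Suc p) c)"
  by (induction n)
    (simp_all add: chain_boundary_singular_subdivision[OF singular_chain_singular_subdivision_power[OF assms]])

text \<open>Instead of a labelled triangulation, an arbitrary labelling is given with an open cover
  none of whose members contains complementary labels. Subdividing until each simplex lies in a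
  member of the cover replaces the condition on edges in the classical statement.\<close>

lemma Ky_Fan_nsphere:
  fixes L :: "(nat \<Rightarrow> real) \<Rightarrow> int"
  assumes "n \<le> d"
    and open_cover: "\<And>U. U \<in> \<C> \<Longrightarrow> openin (nsphere d) U" "topspace (nsphere d) \<subseteq> \<Union>\<C>"
    and odd: "\<And>x. x \<in> topspace (nsphere d) \<Longrightarrow> L (antipode x) = flip (L x)"
    and compl: "\<And>U x y. U \<in> \<C> \<Longrightarrow> x \<in> U \<Longrightarrow> y \<in> U \<Longrightarrow> L y \<noteq> flip (L x)"
  obtains U ls b where "U \<in> \<C>" "set ls \<subseteq> L ` U" "length ls = Suc n" "sorted ls" "alternating b (map odd ls)"
proof -
  let ?X = "nsphere d"
  obtain c a where c: "\<And>k. k \<le> d \<Longrightarrow> singular_chain k ?X (c k)"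
    and a: "singular_simplex 0 ?X a" "c 0 = frag_of a"
    and bd: "\<And>k. k < d \<Longrightarrow> chain_boundary (Suc k) (c (Suc k)) =
           c k + frag_cmul ((-1) ^ Suc k) (chain_map k antipode (c k))"
    using antipodal_chains[of d] by metis
  have "\<exists>N. k \<le> d \<longrightarrow> (\<forall>m f. N \<le> m \<longrightarrow> f \<in> Poly_Mapping.keys ((singular_subdivision k ^^ m) (c k)) \<longrightarrow>
      (\<exists>V\<in>\<C>. f \<in> standard_simplex k \<rightarrow> V))" for k
    by (metis sufficient_iterated_singular_subdivision_exists[OF open_cover c])
  then obtain N where N: "\<And>k m f. k \<le> d \<Longrightarrow> N k \<le> m \<Longrightarrow>
      f \<in> Poly_Mapping.keys ((singular_subdivision k ^^ m) (c k)) \<Longrightarrow>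
      \<exists>V\<in>\<C>. f \<in> standard_simplex k \<rightarrow> V"
    by metis
  \<comment> \<open>One number of subdivisions serves all degrees up to \<open>d\<close>, so the
    subdivided chains still satisfy the boundary relations of the \<open>c k\<close>.\<close>
  define M where "M = Max (N ` {..d})"
  define s where "s k = (singular_subdivision k ^^ M) (c k)" for k
  have small: "\<exists>U\<in>\<C>. \<forall>i\<le>k. simplicial_vertex i \<sigma> \<in> U" if k: "k \<le> d" and \<sigma>: "\<sigma> \<in> Poly_Mapping.keys (s k)" for k \<sigma>
  proof -
    have "N k \<le> M"
      using k by (simp add: M_def)
    then obtain U where "U \<in> \<C>" "\<sigma> \<in> standard_simplex k \<rightarrow> U"
      using N[OF k _ \<sigma>[unfolded s_def]] by blast
    then show ?thesis
      by (intro bexI[of _ U]) (auto simp: simplicial_vertex_def Pi_iff)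
  qed
  have flip: "alternating_count b L k (chain_map k antipode (s k)) = alternating_count (\<not> b) L k (s k)"
    if k: "k \<le> d" for b k
  proof (rule alternating_count_chain_map)
    fix \<sigma>
    assume "\<sigma> \<in> Poly_Mapping.keys (s k)"
    then obtain U where U: "U \<in> \<C>" "\<forall>i\<le>k. simplicial_vertex i \<sigma> \<in> U"
      using small k by blast
    have "U \<subseteq> topspace ?X"
      using open_cover(1)[OF U(1)] by (rule openin_subset)
    with U show "\<exists>U. (\<forall>i\<le>k. simplicial_vertex i \<sigma> \<in> U) \<and> (\<forall>x\<in>U. L (antipode x) = flip (L x)) \<and>
        (\<forall>x\<in>U. \<forall>y\<in>U. L y \<noteq> flip (L x))"
      by (intro exI[of _ U] conjI ballI odd compl) auto
  qed
  \<comment> \<open>Modulo two, the total count in degree \<open>k + 1\<close> is the count of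
    \<open>True\<close>-alternating simplices in the boundary of \<open>s (Suc k)\<close>. That
    boundary consists of \<open>s k\<close> and, up to sign, its antipodal image, which contribute
    the \<open>True\<close> and the \<open>False\<close> count of \<open>s k\<close>. So the parity
    passes from degree to degree.\<close>
  have "k \<le> d \<Longrightarrow> odd (alternating_count True L k (s k) + alternating_count False L k (s k))" for k
  proof (induction k)
    case 0
    \<comment> \<open>Subdivision does nothing in degree 0. A single label alternates for exactly
      one start, so the total is one.\<close>
    have "s 0 = frag_of a"
      using singular_subdivision_power_zero[OF c[of 0]] a(2) by (simp add: s_def)
    then show ?case
      by (simp add: alternating_labels_def vertex_labels_def)
  next
    case (Suc k)
    have "chain_boundary (Suc k) (s (Suc k)) = s k + frag_cmul ((-1) ^ Suc k) (chain_map k antipode (s k))"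
      using Suc.prems unfolding s_def
      by (simp add: chain_boundary_singular_subdivision_power[OF c] bd singular_subdivision_power_add
          singular_subdivision_power_cmul naturality_singular_subdivision_power[OF c] del: power_Suc)
    then have "alternating_count True L k (chain_boundary (Suc k) (s (Suc k))) =
        alternating_count True L k (s k) + (-1) ^ Suc k * alternating_count False L k (s k)"
      using flip[of k True] Suc.prems by (simp add: alternating_count_add alternating_count_cmul del: power_Suc)
    moreover have "even ((-1) ^ Suc k * alternating_count False L k (s k) - alternating_count False L k (s k))"
      by auto
    moreover have "odd (alternating_count True L k (s k) + alternating_count False L k (s k))"
      using Suc by simp
    ultimately show ?case
      using alternating_count_chain_boundary[of True L k "s (Suc k)"] by simp presburger
  qed
  then have "odd (alternating_count True L n (s n) + alternating_count False L n (s n))"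
    using \<open>n \<le> d\<close> .
  then obtain b where "alternating_count b L n (s n) \<noteq> 0"
    by force
  then obtain \<sigma> where \<sigma>: "\<sigma> \<in> Poly_Mapping.keys (s n)" "alternating_labels b (vertex_labels L n \<sigma>)"
    using alternating_count_eq_0 by blast
  obtain U where U: "U \<in> \<C>" "\<And>i. i \<le> n \<Longrightarrow> simplicial_vertex i \<sigma> \<in> U"
    using small[OF \<open>n \<le> d\<close> \<sigma>(1)] by blast
  show thesis
  proof (rule that)
    show "set (sort (vertex_labels L n \<sigma>)) \<subseteq> L ` U"
      using U(2) by (auto simp: vertex_labels_def simp del: upt_Suc)
    show "alternating b (map odd (sort (vertex_labels L n \<sigma>)))"
      using \<sigma>(2) by (simp add: alternating_labels_def)
  qed (use U in simp_all)
qed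

subsection \<open>Circular colorings\<close>

text \<open>Halving a label recovers the color. Colors weakly increase along the sorted list, and by
  opposite parity each step gains at least \<open>q\<close>, in total \<open>n * q\<close>. As
  \<open>n\<close> is odd, the two ends also have opposite parity, so this total is at most
  \<open>p - q\<close>.\<close>

lemma alternating_labels_gap:
  fixes ls :: "int list" and p q :: int
  assumes "sorted ls" "alternating b (map odd ls)" "length ls = Suc n" "odd n"
    and gap: "\<And>l l'. l \<in> set ls \<Longrightarrow> l' \<in> set ls \<Longrightarrow> odd l \<noteq> odd l' \<Longrightarrow>
      q \<le> \<bar>l div 2 - l' div 2\<bar> \<and> \<bar>l div 2 - l' div 2\<bar> \<le> p - q"
  shows "int (Suc n) * q \<le> p"
proof -
  have parity: "odd (ls ! i) = (if even i then b else \<not> b)" if "i \<le> n" for i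
    using alternating_nth[OF assms(2), of i] that assms(3) by simp
  have "ls ! 0 div 2 + int i * q \<le> ls ! i div 2" if "i \<le> n" for i
    using that
  proof (induction i)
    case (Suc i)
    have "ls ! i div 2 \<le> ls ! Suc i div 2"
      using assms(1,3) Suc.prems by (intro zdiv_mono1 sorted_nth_mono) auto
    moreover have "q \<le> \<bar>ls ! i div 2 - ls ! Suc i div 2\<bar>"
      using gap[of "ls ! i" "ls ! Suc i"] parity[of i] parity[of "Suc i"] Suc.prems assms(3)
      by (cases b; cases "even i") simp_all
    ultimately show ?case
      using Suc by (simp add: algebra_simps)
  qed simp
  then have "ls ! 0 div 2 + int n * q \<le> ls ! n div 2"
    by simp
  moreover have "\<bar>ls ! 0 div 2 - ls ! n div 2\<bar> \<le> p - q"
    using gap[of "ls ! 0" "ls ! n"] parity[of 0] parity[of n] assms(3,4) by simp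
  ultimately show ?thesis
    by (simp add: algebra_simps)
qed

text \<open>Were all admissible dimensions below \<open>n\<close>, their supremum would be at most
  \<open>n - 1\<close>. Positivity of \<open>n\<close> rules out the empty supremum 0. The dimension
  obtained may exceed \<open>n\<close>, which the form of Fan's theorem above allows for.\<close>

lemma coind_ge_obtain:
  assumes "coind X \<nu> \<ge> enat n" "n > 0"
  obtains d f where "n \<le> d" "continuous_map (nsphere d) X f"
    "\<And>x. x \<in> topspace (nsphere d) \<Longrightarrow> f (antipode x) = \<nu> (f x)"
proof -
  let ?D = "{d. \<exists>f. continuous_map (nsphere d) X f \<and>
      (\<forall>x \<in> topspace (nsphere d). f (\<lambda>i. - x i) = \<nu> (f x))}"
  have "\<exists>d\<in>?D. n \<le> d"
  proof (rule ccontr)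
    assume "\<not> ?thesis"
    then have "e \<le> enat (n - 1)" if "e \<in> {enat d | d. d \<in> ?D}" for e
      using that by fastforce
    then have "coind X \<nu> \<le> enat (n - 1)"
      unfolding coind_def by (intro Sup_least) auto
    then have "enat n \<le> enat (n - 1)"
      using assms(1) by (rule order_trans[rotated])
    then show False
      using assms(2) by simp
  qed
  then show thesis
    using that by blast
qed

lemma pq_coloring_ge_of_equivariant_map:
  assumes G: "pair_graph G" and col: "pq_coloring G p q c" and "0 < q"
    and f: "continuous_map (nsphere d) (geometric_realization (box_complex G)) f"
    and equivariant: "\<And>x. x \<in> topspace (nsphere d) \<Longrightarrow> f (antipode x) = box_involution (f x)"
    and "n \<le> d" "odd n"
  shows "int (Suc n) * int q \<le> int p"
proof -
  interpret pair_graph G by fact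
  let ?S = "topspace (nsphere d)"
  define W where "W = pverts G \<times> (UNIV :: bool set)"
  \<comment> \<open>The average weight: the coordinates of a point sum to one over at most
    \<open>card W\<close> vertices, so one of them is at least \<open>\<epsilon>\<close>.\<close>
  define \<epsilon> :: real where "\<epsilon> = 1 / card W"
  have "finite W"
    by (simp add: W_def)
  have supp: "{w. f x w \<noteq> 0} \<in> box_complex G"
    and sum1: "(\<Sum>w | f x w \<noteq> 0. f x w) = 1" if "x \<in> ?S" for x
    using continuous_map_image_subset_topspace[OF f] that
    by (auto simp: geometric_realization_def image_subset_iff)
  have supp_W: "{w. f x w \<noteq> 0} \<subseteq> W" if "x \<in> ?S" for x
    using supp[OF that] by (auto simp: box_complex_def W_def)
  have large: "\<exists>w. \<epsilon> \<le> f x w" if x: "x \<in> ?S" for x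
  proof (rule ccontr)
    assume "\<nexists>w. \<epsilon> \<le> f x w"
    then have less: "f x w < \<epsilon>" for w
      by (meson not_le)
    have fin: "finite {w. f x w \<noteq> 0}"
      using supp_W[OF x] \<open>finite W\<close> by (rule finite_subset)
    have "{w. f x w \<noteq> 0} \<noteq> {}"
      using sum1[OF x] by (metis sum.empty zero_neq_one)
    then have "(\<Sum>w | f x w \<noteq> 0. f x w) < (\<Sum>w | f x w \<noteq> 0. \<epsilon>)"
      using fin less by (intro sum_strict_mono) auto
    also have "\<dots> \<le> card W * \<epsilon>"
      using card_mono[OF \<open>finite W\<close> supp_W[OF x]] by (simp add: \<epsilon>_def divide_right_mono)
    also have "\<dots> \<le> 1"
      by (simp add: \<epsilon>_def)
    finally show False
      using sum1[OF x] by simp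
  qed
  have "W \<noteq> {}"
    using large[OF in_topspace_nsphere] sum1[OF in_topspace_nsphere] supp_W[OF in_topspace_nsphere]
    by (metis subset_empty sum.empty zero_neq_one)
  then have "0 < \<epsilon>"
    using \<open>finite W\<close> by (simp add: \<epsilon>_def card_gt_0_iff)
  have antipode_S: "antipode x \<in> ?S" if "x \<in> ?S" for x
    using continuous_map_image_subset_topspace[OF continuous_map_antipode] that by blast
  have antipode_neq: "antipode x \<noteq> x" if "x \<in> ?S" for x
  proof
    assume "antipode x = x"
    then have "x i = 0" for i
      by (metis equal_neg_zero)
    then show False
      using that by (simp add: nsphere)
  qed
  \<comment> \<open>A choice from each antipodal pair makes the choice of a heavy vertex equivariant.\<close>
  define r where "r x = (SOME y. y \<in> {x, antipode x})" for x
  have r: "r x \<in> {x, antipode x}" for x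
    unfolding r_def by (rule someI[of _ x]) simp
  \<comment> \<open>The sets \<open>{x, antipode x}\<close> belonging to \<open>x\<close> and to
    \<open>antipode x\<close> are equal, so \<open>SOME\<close> picks the same element.\<close>
  have r_antipode: "r (antipode x) = r x" for x
    by (simp add: r_def insert_commute)
  define heavy where "heavy x = (SOME w. \<epsilon> \<le> f x w)" for x
  have heavy: "\<epsilon> \<le> f x (heavy x)" if "x \<in> ?S" for x
    unfolding heavy_def using large[OF that] by (rule someI_ex)
  define w where "w x = (if r x = x then heavy x else map_prod id Not (heavy (antipode x)))" for x
  have w_large: "\<epsilon> \<le> f x (w x)" if x: "x \<in> ?S" for x
  proof (cases "r x = x")
    case False
    obtain v b where vb: "heavy (antipode x) = (v, b)"
      by (cases "heavy (antipode x)")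
    have "\<epsilon> \<le> f (antipode x) (v, b)"
      using heavy[OF antipode_S[OF x]] vb by simp
    then show ?thesis
      using False vb equivariant[OF x] by (simp add: w_def box_involution_def)
  qed (use heavy[OF x] in \<open>simp add: w_def\<close>)
  have w_antipode: "w (antipode x) = map_prod id Not (w x)" if x: "x \<in> ?S" for x
  proof (cases "r x = x")
    case True
    then show ?thesis
      using r_antipode[of x] antipode_neq[OF x] by (simp add: w_def)
  next
    case False
    then have "r (antipode x) = antipode x"
      using r[of x] r_antipode[of x] by simp
    then show ?thesis
      using False by (cases "heavy (antipode x)") (simp add: w_def)
  qed
  define L where "L x = 2 * c (fst (w x)) + of_bool (snd (w x))" for x
  have odd_L: "odd (L x) = snd (w x)" and div_L: "L x div 2 = c (fst (w x))" for x
    by (auto simp: L_def)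
  \<comment> \<open>Within \<open>U y\<close> no coordinate in \<open>W\<close> differs from its
    value at \<open>y\<close> by \<open>\<epsilon>\<close> or more. A vertex of weight at least
    \<open>\<epsilon>\<close> at a point of \<open>U y\<close> thus keeps positive weight at
    \<open>y\<close>, so all chosen vertices lie in the one simplex supporting
    \<open>f y\<close>.\<close>
  define U where "U y = (\<Inter>u\<in>W. {x \<in> ?S. f x u \<in> ball (f y u) \<epsilon>})" for y
  have open_U: "openin (nsphere d) (U y)" for y
    unfolding U_def
  proof (intro openin_Inter)
    fix T
    assume "T \<in> (\<lambda>u. {x \<in> ?S. f x u \<in> ball (f y u) \<epsilon>}) ` W"
    then obtain u where T: "T = {x \<in> ?S. f x u \<in> ball (f y u) \<epsilon>}"
      by (rule imageE)
    have "continuous_map (nsphere d) (powertop_real UNIV) f"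
      using f unfolding geometric_realization_def by (rule continuous_map_into_fulltopology)
    then have "continuous_map (nsphere d) euclideanreal (\<lambda>x. f x u)"
      unfolding continuous_map_componentwise_UNIV by blast
    then show "openin (nsphere d) T"
      unfolding T by (rule openin_continuous_map_preimage) simp
  qed (use \<open>finite W\<close> \<open>W \<noteq> {}\<close> in auto)
  have U_S: "U y \<subseteq> ?S" for y
    using open_U by (rule openin_subset)
  have in_supp: "w x \<in> {u. f y u \<noteq> 0}" if "y \<in> ?S" "x \<in> U y" for x y
  proof -
    have x: "x \<in> ?S"
      using that U_S by blast
    have "f x (w x) \<noteq> 0"
      using w_large[OF x] \<open>0 < \<epsilon>\<close> by simp
    then have "w x \<in> W"
      using supp_W[OF x] by blast
    then have "dist (f y (w x)) (f x (w x)) < \<epsilon>"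
      using that(2) by (auto simp: U_def)
    then show ?thesis
      using w_large[OF x] by (auto simp: dist_real_def)
  qed
  have gap: "int q \<le> \<bar>l div 2 - l' div 2\<bar> \<and> \<bar>l div 2 - l' div 2\<bar> \<le> int p - int q"
    if y: "y \<in> ?S" and l: "l \<in> L ` U y" "l' \<in> L ` U y" "odd l \<noteq> odd l'" for y l l'
  proof -
    obtain x x' where x: "x \<in> U y" "l = L x" "x' \<in> U y" "l' = L x'"
      using l by blast
    have "snd (w x) \<noteq> snd (w x')"
      using l(3) x by (simp add: odd_L)
    moreover obtain A B where AB: "{u. f y u \<noteq> 0} = A \<times> {False} \<union> B \<times> {True}" "A \<times> B \<subseteq> parcs G"
      using supp[OF y] unfolding box_complex_def by blast
    have "w x \<in> A \<times> {False} \<union> B \<times> {True}" "w x' \<in> A \<times> {False} \<union> B \<times> {True}"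
      using in_supp[OF y] x AB(1) by blast+
    ultimately have "(fst (w x), fst (w x')) \<in> parcs G \<or> (fst (w x'), fst (w x)) \<in> parcs G"
      using AB(2) by (cases "w x"; cases "w x'") auto
    then have "(fst (w x), fst (w x')) \<in> parcs G"
      using arcs_symmetric by blast
    then show ?thesis
      using col x unfolding pq_coloring_def by (auto simp: div_L)
  qed
  obtain V ls b where V: "V \<in> U ` ?S" and ls: "set ls \<subseteq> L ` V" "length ls = Suc n" "sorted ls"
      "alternating b (map odd ls)"
  proof (rule Ky_Fan_nsphere[OF \<open>n \<le> d\<close>, of "U ` ?S" L])
    show "openin (nsphere d) V" if "V \<in> U ` ?S" for V
      using that open_U by blast
    show "?S \<subseteq> \<Union> (U ` ?S)"
      using \<open>0 < \<epsilon>\<close> by (auto simp: U_def)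
    show "L (antipode x) = flip (L x)" if "x \<in> ?S" for x
      by (simp add: L_def w_antipode[OF that] flip_def)
    show "L x' \<noteq> flip (L x)" if V: "V \<in> U ` ?S" "x \<in> V" "x' \<in> V" for V x x'
    proof
      \<comment> \<open>Complementary labels have equal colors but opposite parities, so
        \<open>gap\<close> would give \<open>q \<le> 0\<close>.\<close>
      assume eq: "L x' = flip (L x)"
      then have "odd (L x) \<noteq> odd (L x')" "L x div 2 = L x' div 2"
        by (auto simp: flip_def elim: oddE)
      then show False
        using V gap \<open>0 < q\<close> by fastforce
    qed
  qed
  show ?thesis
    using ls(3,4,2) \<open>odd n\<close>
  proof (rule alternating_labels_gap)
    fix l l'
    assume "l \<in> set ls" "l' \<in> set ls" "odd l \<noteq> odd l'"
    then show "int q \<le> \<bar>l div 2 - l' div 2\<bar> \<and> \<bar>l div 2 - l' div 2\<bar> \<le> int p - int q"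
      using V ls(1) gap by blast
  qed
qed

text \<open>Ensures that the infimum defining the circular chromatic number is over a nonempty set,
  as \<open>cInf_greatest\<close> requires. Taking one color more than there are vertices keeps
  \<open>p\<close> positive even for the graph without vertices.\<close>

lemma pq_coloring_exists:
  assumes "pair_graph G"
  obtains p c where "0 < p" "pq_coloring G p 1 c"
proof -
  interpret pair_graph G by fact
  obtain g where g: "inj_on g (pverts G)" "g ` pverts G = {0..<card (pverts G)}"
    using ex_bij_betw_finite_nat[OF finite_verts] unfolding bij_betw_def by blast
  have g_less: "g v < card (pverts G)" if "v \<in> pverts G" for v
    using that g(2) by auto
  have "pq_coloring G (Suc (card (pverts G))) 1 (\<lambda>v. int (Suc (g v)))"
    unfolding pq_coloring_def
  proof (intro conjI ballI)
    show "(\<lambda>v. int (Suc (g v))) ` pverts G \<subseteq> {1..int (Suc (card (pverts G)))}"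
    proof (rule image_subsetI)
      fix v
      assume "v \<in> pverts G"
      then show "int (Suc (g v)) \<in> {1..int (Suc (card (pverts G)))}"
        using less_imp_le[OF g_less] by simp
    qed
    fix e
    assume e: "e \<in> parcs G"
    obtain u v where uv: "e = (u, v)"
      by (cases e)
    have "u \<in> pverts G" "v \<in> pverts G" "u \<noteq> v"
      using e uv wellformed' no_loops' by blast+
    moreover from this have "g u \<noteq> g v" "g u < card (pverts G)" "g v < card (pverts G)"
      using g(1) g_less by (auto simp: inj_on_eq_iff)
    ultimately show "case e of (u, v) \<Rightarrow> int 1 \<le> \<bar>int (Suc (g u)) - int (Suc (g v))\<bar> \<and>
        \<bar>int (Suc (g u)) - int (Suc (g v))\<bar> \<le> int (Suc (card (pverts G))) - int 1"
      using uv by auto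
  qed
  then show thesis
    using that by blast
qed

theorem theorem2p6:
  fixes G :: "'a pair_pre_digraph" and t :: nat
  assumes "pair_graph G"
    and "t > 0" and "even t"
    and "coind (geometric_realization (box_complex G)) box_involution \<ge> enat (t - 1)"
  shows "circular_chromatic_number G \<ge> real t"
proof -
  \<comment> \<open>A positive even \<open>t\<close> is at least 2, so the dimension
    \<open>t - 1\<close> is positive, as extracting a map from the coindex requires.\<close>
  have t: "odd (t - 1)" "0 < t - 1" "Suc (t - 1) = t"
    using assms(2,3) by (auto elim: evenE)
  obtain d f where df: "t - 1 \<le> d" "continuous_map (nsphere d) (geometric_realization (box_complex G)) f"
    "\<And>x. x \<in> topspace (nsphere d) \<Longrightarrow> f (antipode x) = box_involution (f x)"
    using coind_ge_obtain[OF assms(4) t(2)] by blast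
  obtain p0 c0 where p0: "0 < p0" "pq_coloring G p0 1 c0"
    using pq_coloring_exists[OF assms(1)] by blast
  show ?thesis
    unfolding circular_chromatic_number_def
  proof (rule cInf_greatest)
    show "{real p / real q | p q. 0 < p \<and> 0 < q \<and> (\<exists>c. pq_coloring G p q c)} \<noteq> {}"
      using p0 by blast
    fix x
    assume "x \<in> {real p / real q | p q. 0 < p \<and> 0 < q \<and> (\<exists>c. pq_coloring G p q c)}"
    then obtain p q c where pq: "x = real p / real q" "0 < q" "pq_coloring G p q c"
      by blast
    have "int t * int q \<le> int p"
      using pq_coloring_ge_of_equivariant_map[OF assms(1) pq(3,2) df(2,3,1) t(1)] t(3) by simp
    then have "real t * real q \<le> real p"
      by (simp flip: of_nat_mult)
    then show "real t \<le> x"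
      using pq(1,2) by (simp add: pos_le_divide_eq)
  qed
qed

end
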